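(* For every integer $n\ge1$ there are polynomials $R_n(t)$ and $G_n(t)$ of degrees $n-1$ and $n$, respectively, such that for all $x\in\mathbb{R}$ $$\sin(2nx)=R_n(\sin^2(x))\sin(x)\cos(x),$$ $$\cos(2nx)=G_n(\cos^2(x)).$$ *)

theory Defs
  imports Complex_Main "HOL-Computational_Algebra.Polynomial"
begin

end

theory Submission
  imports Defs
begin

text \<open>
  For a fixed angle \<open>y = 2 * x\<close>, the addition theorems show that both \<open>cos (n * y)\<close> and
  \<open>sin (n * y)\<close> solve the recurrence \<open>f (n + 2) = 2 * cos y * f (n + 1) - f n\<close>. The factor
  \<open>2 * cos y\<close> is a polynomial of degree 1 in \<open>(cos x)\<^sup>2\<close>, namely \<open>4 * (cos x)\<^sup>2 - 2\<close>, and also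
  in \<open>(sin x)\<^sup>2\<close>, namely \<open>2 - 4 * (sin x)\<^sup>2\<close>. Running the same recurrence on polynomials thus
  produces \<open>G\<close> from the initial values \<open>1\<close> and \<open>2 * t - 1\<close> at \<open>n = 0, 1\<close>, and \<open>R\<close> from the
  initial values \<open>2\<close> and \<open>4 - 8 * t\<close> at \<open>n = 1, 2\<close>. Each step multiplies by a factor of degree
  1 and subtracts a polynomial of smaller degree, so the degree grows by exactly 1
  (\<open>degree_three_term\<close>). These are the Chebyshev polynomials of both kinds, up to a linear change
  of variable and, for \<open>R\<close>, a factor 2.
\<close>

fun three_term :: "'a::idom poly \<Rightarrow> 'a poly \<Rightarrow> 'a poly \<Rightarrow> nat \<Rightarrow> 'a poly" where
  "three_term L p q 0 = p"
| "three_term L p q (Suc 0) = q"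
| "three_term L p q (Suc (Suc n)) = L * three_term L p q (Suc n) - three_term L p q n"

text \<open>
  The leading term of \<open>L * three_term L p q (Suc n)\<close> cannot cancel, because the subtracted
  polynomial has degree lower by 2.
\<close>

lemma degree_three_term:
  assumes "degree L = 1" "degree p = 0" "degree q = 1"
  shows "degree (three_term L p q n) = n"
  using assms
proof (induction L p q n rule: three_term.induct)
  case (3 L p q n)
  have IH: "degree (three_term L p q (Suc n)) = Suc n" "degree (three_term L p q n) = n"
    using 3 by simp_all
  have "L \<noteq> 0" "three_term L p q (Suc n) \<noteq> 0"
    using IH(1) 3(3) by auto
  then have "degree (L * three_term L p q (Suc n)) = Suc (Suc n)"
    using IH(1) 3(3) by (simp add: degree_mult_eq)
  moreover have "degree (- three_term L p q n) < Suc (Suc n)"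
    using IH(2) by simp
  ultimately show ?case
    using degree_add_eq_left[of "- three_term L p q n" "L * three_term L p q (Suc n)"] by simp
qed simp_all

text \<open>
  The constant factor \<open>w\<close> stands for \<open>sin x * cos x\<close> in the case of the sine: it may vanish, so
  it cannot be divided out of \<open>f\<close> beforehand.
\<close>

lemma recurrence_eq_poly_three_term:
  assumes "f 0 = poly p t * w" "f (Suc 0) = poly q t * w"
    and "\<And>n. f (Suc (Suc n)) = poly L t * f (Suc n) - f n"
  shows "f n = poly (three_term L p q n) t * w"
  using assms
proof (induction L p q n rule: three_term.induct)
  case (3 L p q n)
  have "f (Suc n) = poly (three_term L p q (Suc n)) t * w" "f n = poly (three_term L p q n) t * w"
    using 3 by blast+
  then show ?case
    by (simp add: "3.prems"(3) left_diff_distrib mult.assoc)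
qed simp_all

lemma cos_multiple_recurrence:
  fixes a y :: real
  shows "cos (a + 2 * y) = 2 * cos y * cos (a + y) - cos a"
proof -
  have "cos (a + 2 * y) = cos ((a + y) + y)" "cos a = cos ((a + y) - y)"
    by (simp_all add: algebra_simps)
  then show ?thesis
    by (simp only: cos_add[of "a + y" y] cos_diff[of "a + y" y]) simp
qed

lemma sin_multiple_recurrence:
  fixes a y :: real
  shows "sin (a + 2 * y) = 2 * cos y * sin (a + y) - sin a"
proof -
  have "sin (a + 2 * y) = sin ((a + y) + y)" "sin a = sin ((a + y) - y)"
    by (simp_all add: algebra_simps)
  then show ?thesis
    by (simp only: sin_add[of "a + y" y] sin_diff[of "a + y" y]) simp
qed

lemma cos_even_multiple_eq_poly:
  fixes x :: real
  shows "cos (2 * real n * x) = poly (three_term [:-2, 4:] 1 [:-1, 2:] n) ((cos x)\<^sup>2)"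
proof -
  have double_angle: "poly [:-2, 4:] ((cos x)\<^sup>2) = 2 * cos (2 * x)"
    by (simp add: cos_double_cos)
  have "cos (2 * real (Suc (Suc k)) * x) = poly [:-2, 4:] ((cos x)\<^sup>2) * cos (2 * real (Suc k) * x)
      - cos (2 * real k * x)" for k
    unfolding double_angle
    using cos_multiple_recurrence[of "2 * real k * x" "2 * x"] by (simp add: algebra_simps)
  then show ?thesis
    using recurrence_eq_poly_three_term
      [where f = "\<lambda>k. cos (2 * real k * x)" and w = 1 and p = 1 and q = "[:-1, 2:]"]
    by (simp add: cos_double_cos)
qed

text \<open>
  The index is shifted by one: the recurrence starts at \<open>sin (2 * x)\<close> rather than at
  \<open>sin 0 = 0\<close>, so that the degrees of the initial polynomials are 0 and 1.
\<close>

lemma sin_even_multiple_eq_poly: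
  fixes x :: real
  shows "sin (2 * real (Suc n) * x) =
    poly (three_term [:2, -4:] [:2:] [:4, -8:] n) ((sin x)\<^sup>2) * (sin x * cos x)"
proof (rule recurrence_eq_poly_three_term[where f = "\<lambda>k. sin (2 * real (Suc k) * x)"])
  show "sin (2 * real (Suc 0) * x) = poly [:2:] ((sin x)\<^sup>2) * (sin x * cos x)"
    by (simp add: sin_double)
next
  have "sin (2 * real (Suc (Suc 0)) * x) = sin (2 * (2 * x))"
    by simp
  also have "\<dots> = 2 * (2 * sin x * cos x) * (1 - 2 * (sin x)\<^sup>2)"
    by (simp only: sin_double[of "2 * x"] sin_double[of x] cos_double_sin)
  finally show "sin (2 * real (Suc (Suc 0)) * x) = poly [:4, -8:] ((sin x)\<^sup>2) * (sin x * cos x)"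
    by (simp add: algebra_simps)
next
  have double_angle: "poly [:2, -4:] ((sin x)\<^sup>2) = 2 * cos (2 * x)"
    by (simp add: cos_double_sin)
  show "sin (2 * real (Suc (Suc (Suc k))) * x) =
      poly [:2, -4:] ((sin x)\<^sup>2) * sin (2 * real (Suc (Suc k)) * x) - sin (2 * real (Suc k) * x)" for k
    unfolding double_angle
    using sin_multiple_recurrence[of "2 * real (Suc k) * x" "2 * x"] by (simp add: algebra_simps)
qed

theorem theorem2p5:
  fixes n :: nat
  assumes "n \<ge> 1"
  shows "\<exists>R G :: real poly. degree R = n - 1 \<and> degree G = n \<and>
    (\<forall>x :: real.
       sin (2 * real n * x) = poly R ((sin x)\<^sup>2) * sin x * cos x \<and>
       cos (2 * real n * x) = poly G ((cos x)\<^sup>2))"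
proof (intro exI conjI allI)
  let ?R = "three_term [:2, -4:] [:2:] [:4, -8:] (n - 1) :: real poly"
  let ?G = "three_term [:-2, 4:] 1 [:-1, 2:] n :: real poly"
  show "degree ?R = n - 1" "degree ?G = n"
    by (simp_all add: degree_three_term)
  show "sin (2 * real n * x) = poly ?R ((sin x)\<^sup>2) * sin x * cos x" for x
    using sin_even_multiple_eq_poly[of "n - 1" x] assms by (simp add: mult.assoc)
  show "cos (2 * real n * x) = poly ?G ((cos x)\<^sup>2)" for x
    by (rule cos_even_multiple_eq_poly)
qed

end
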